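(* Let $k$ be a commutative ring of characteristic $0$, and let $\mathcal{A}=k[Y^\infty]_h$ be the $k$-module of planar binary trees with loops, with the product $\ast_h$ and the co-product $\Delta_h$ (all defined in the context). Then $\mathcal{A}$ with the product $\ast_h$ and the co-product $\Delta_h$ is a Hopf algebra.
   Context: Planar binary trees. $Y^n$ is the set of planar binary rooted trees with $n$ internal (trivalent) vertices ($n$ is called the order); such a tree has $n+1$ leaves, numbered $0,\dots,n$ from left to right. $Y^0=\{|\}$, where $|$ is the tree with a single edge and no vertex. The grafting $t_1\vee t_2$ of $t_1\in Y^p$ and $t_2\in Y^q$ is the tree in $Y^{p+q+1}$ whose left branch at the root is $t_1$ and whose right branch is $t_2$. Every tree of order $n\ge 1$ is uniquely of this form. Graphs with loops. A graph $t^g$ of order $n$ with $g$ loops is obtained from a tree $t\in Y^n$ by joining, for each of $g$ distinct indices $i\in\{0,\dots,n-1\}$, the consecutive leaves $i$ and $i+1$ by an additional edge (a loop). So it is encoded by a pair $(t,S)$ with $t\in Y^n$, $S\subseteq\{0,\dots,n-1\}$, $|S|=g$, where $i\in S$ means that leaves $i$ and $i+1$ are joined. The same leaf may be involved in two loops (i.e. $i,i+1\in S$ is allowed); such graphs are called irregular. $(Y^n)^g$ denotes the set of all such graphs of order $n$ with $g$ loops, and $k[Y^\infty]_h$ is the free $k$-module on $\bigcup_{n,g}(Y^n)^g$. Grafting operations. For $t^{g_1}=(t_1,S_1)\in (Y^p)^{g_1}$ and $t^{g_2}=(t_2,S_2)\in(Y^q)^{g_2}$ put $$t^{g_1}\vee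 t^{g_2}=\bigl(t_1\vee t_2,\;S_1\cup (S_2+p+1)\bigr)\in (Y^{p+q+1})^{g_1+g_2},$$ $$t^{g_1}\overset{\frown}{\vee} t^{g_2}=\bigl(t_1\vee t_2,\;S_1\cup\{p\}\cup (S_2+p+1)\bigr)\in (Y^{p+q+1})^{g_1+g_2+1},$$ i.e. in the second case the last leaf of $t^{g_1}$ and the first leaf of $t^{g_2}$ are additionally joined by a loop. Both operations are extended bilinearly. Every graph of order $\ge1$ is uniquely of exactly one of the forms $a\vee b$ or $a\overset{\frown}{\vee}b$. Product. $\ast_h$ is the $k$-bilinear product on $k[Y^\infty]_h$ determined recursively by $x\ast_h |=|\ast_h x=x$ (so $1=|$ is the unit) and, for graphs $x=x'\,\square_1\,x''$ and $y=y'\,\square_2\,y''$ with $\square_1,\square_2\in\{\vee,\overset{\frown}{\vee}\}$, $$x\ast_h y=(x\ast_h y')\,\square_2\,y''+x'\,\square_1\,(x''\ast_h y).$$ Co-product. $\Delta_h:k[Y^\infty]_h\to k[Y^\infty]_h\otimes_k k[Y^\infty]_h$ is the $k$-linear map determined recursively by $\Delta_h(|)=|\otimes|$ and, for a graph $x=a\,\square\,b$ with $\square\in\{\vee,\overset{\frown}{\vee}\}$, writing $\Delta_h(a)=\sum a_{(1)}\otimes a_{(2)}$ and $\Delta_h(b)=\sum b_{(1)}\otimes b_{(2)}$, $$\Delta_h(a\,\square\,b)=\sum \bigl(a_{(1)}\ast_h b_{(1)}\bigr)\otimes\bigl(a_{(2)}\,\square\,b_{(2)}\bigr)+(a\,\square\,b)\otimes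 |.$$ *)

theory Defs
  imports Complex_Main "HOL-Library.Poly_Mapping"
begin

section \<open>Free modules and their tensor products\<close>

text \<open>
  The free \<open>k\<close>-module on a set \<open>'a\<close> of basis elements is the type \<open>'a \<Rightarrow>\<^sub>0 'k\<close> of
  finitely supported functions.  The multiplication that the library puts on this
  type for monoids \<open>'a\<close> is never used.
\<close>

definition fscale :: "'k::comm_ring_1 \<Rightarrow> ('a \<Rightarrow>\<^sub>0 'k) \<Rightarrow> ('a \<Rightarrow>\<^sub>0 'k)" where
  "fscale c p = Poly_Mapping.map ((*) c) p"

definition basis :: "'a \<Rightarrow> ('a \<Rightarrow>\<^sub>0 'k::comm_ring_1)" where
  "basis x = Poly_Mapping.single x 1"

definition lin_ext ::
  "('k::comm_ring_1 \<Rightarrow> 'm::ab_group_add \<Rightarrow> 'm) \<Rightarrow> ('a \<Rightarrow> 'm) \<Rightarrow> ('a \<Rightarrow>\<^sub>0 'k) \<Rightarrow> 'm" where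
  "lin_ext s f p = (\<Sum>x\<in>Poly_Mapping.keys p. s (Poly_Mapping.lookup p x) (f x))"

definition bilin_ext ::
  "('a \<Rightarrow> 'b \<Rightarrow> ('c \<Rightarrow>\<^sub>0 'k)) \<Rightarrow> ('a \<Rightarrow>\<^sub>0 'k) \<Rightarrow> ('b \<Rightarrow>\<^sub>0 'k) \<Rightarrow> ('c \<Rightarrow>\<^sub>0 'k::comm_ring_1)" where
  "bilin_ext f p q = lin_ext fscale (\<lambda>x. lin_ext fscale (f x) q) p"

definition bilinear_map ::
  "('k::comm_ring_1 \<Rightarrow> 'm::ab_group_add \<Rightarrow> 'm) \<Rightarrow> ('k \<Rightarrow> 'n::ab_group_add \<Rightarrow> 'n) \<Rightarrow>
   ('k \<Rightarrow> 'l::ab_group_add \<Rightarrow> 'l) \<Rightarrow> ('m \<Rightarrow> 'n \<Rightarrow> 'l) \<Rightarrow> bool" where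
  "bilinear_map s1 s2 s3 f \<longleftrightarrow>
     (\<forall>x. module_hom s2 s3 (f x)) \<and> (\<forall>y. module_hom s1 s3 (\<lambda>x. f x y))"

text \<open>
  The tensor product of the free modules on \<open>'a\<close> and \<open>'b\<close> is realised as the free
  module on \<open>'a \<times> 'b\<close>; the universal property is proved below as
  \<open>tensor_universal\<close>.  For a bilinear map \<open>f\<close>, \<open>tensor_lift s f\<close> is the linear map
  that sends every pure tensor \<open>tensor p q\<close> to \<open>f p q\<close>, so that
  \<open>tensor_lift s (\<lambda>x\<^sub>1 x\<^sub>2. f x\<^sub>1 x\<^sub>2) u\<close> stands for the sum of all \<open>f u\<^sub>1 u\<^sub>2\<close>,
  where \<open>u\<close> is the sum of all \<open>tensor u\<^sub>1 u\<^sub>2\<close> in Sweedler notation.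
\<close>

definition tensor ::
  "('a \<Rightarrow>\<^sub>0 'k::comm_ring_1) \<Rightarrow> ('b \<Rightarrow>\<^sub>0 'k) \<Rightarrow> ('a \<times> 'b \<Rightarrow>\<^sub>0 'k)" where
  "tensor p q = bilin_ext (\<lambda>x y. basis (x, y)) p q"

definition tensor_lift ::
  "('k::comm_ring_1 \<Rightarrow> 'm::ab_group_add \<Rightarrow> 'm) \<Rightarrow>
   (('a \<Rightarrow>\<^sub>0 'k) \<Rightarrow> ('b \<Rightarrow>\<^sub>0 'k) \<Rightarrow> 'm) \<Rightarrow> ('a \<times> 'b \<Rightarrow>\<^sub>0 'k) \<Rightarrow> 'm" where
  "tensor_lift s f = lin_ext s (\<lambda>(x, y). f (basis x) (basis y))"

definition tensor_map ::
  "(('a \<Rightarrow>\<^sub>0 'k::comm_ring_1) \<Rightarrow> ('c \<Rightarrow>\<^sub>0 'k)) \<Rightarrow> (('b \<Rightarrow>\<^sub>0 'k) \<Rightarrow> ('d \<Rightarrow>\<^sub>0 'k)) \<Rightarrow>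
   ('a \<times> 'b \<Rightarrow>\<^sub>0 'k) \<Rightarrow> ('c \<times> 'd \<Rightarrow>\<^sub>0 'k)" where
  "tensor_map f g = tensor_lift fscale (\<lambda>p q. tensor (f p) (g q))"

definition tensor_assoc ::
  "(('a \<times> 'b) \<times> 'c \<Rightarrow>\<^sub>0 'k::comm_ring_1) \<Rightarrow> ('a \<times> ('b \<times> 'c) \<Rightarrow>\<^sub>0 'k)" where
  "tensor_assoc =
     tensor_lift fscale (\<lambda>u r. tensor_lift fscale (\<lambda>p q. tensor p (tensor q r)) u)"

text \<open>The product \<open>(p \<otimes> q) (p' \<otimes> q') = p p' \<otimes> q q'\<close> on the tensor square.\<close>

definition tensor_mult ::
  "(('a \<Rightarrow>\<^sub>0 'k) \<Rightarrow> ('a \<Rightarrow>\<^sub>0 'k) \<Rightarrow> ('a \<Rightarrow>\<^sub>0 'k::comm_ring_1)) \<Rightarrow>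
   ('a \<times> 'a \<Rightarrow>\<^sub>0 'k) \<Rightarrow> ('a \<times> 'a \<Rightarrow>\<^sub>0 'k) \<Rightarrow> ('a \<times> 'a \<Rightarrow>\<^sub>0 'k)" where
  "tensor_mult m u v =
     tensor_lift fscale (\<lambda>p q. tensor_lift fscale (\<lambda>p' q'. tensor (m p p') (m q q')) v) u"

lemma lookup_fscale [simp]: "Poly_Mapping.lookup (fscale c p) x = c * Poly_Mapping.lookup p x"
  by (simp add: fscale_def Poly_Mapping.map.rep_eq when_def)

lemma module_fscale: "module fscale"
  by unfold_locales (auto intro!: poly_mapping_eqI simp: lookup_add algebra_simps)

lemma lin_ext_superset:
  assumes "module s" "finite X" "Poly_Mapping.keys p \<subseteq> X"
  shows "lin_ext s f p = (\<Sum>x\<in>X. s (Poly_Mapping.lookup p x) (f x))"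
proof -
  interpret module s by fact
  show ?thesis unfolding lin_ext_def
    by (rule sum.mono_neutral_left) (use assms in \<open>auto simp: in_keys_iff\<close>)
qed

lemma module_hom_lin_ext:
  fixes s :: "'k::comm_ring_1 \<Rightarrow> 'm::ab_group_add \<Rightarrow> 'm" and f :: "'a \<Rightarrow> 'm"
  assumes "module s"
  shows "module_hom fscale s (lin_ext s f)"
proof -
  interpret m: module s by fact
  interpret f: module fscale by (rule module_fscale)
  show ?thesis
  proof
    fix p q :: "'a \<Rightarrow>\<^sub>0 'k" and c :: 'k
    let ?X = "Poly_Mapping.keys p \<union> Poly_Mapping.keys q"
    have "Poly_Mapping.keys (p + q) \<subseteq> ?X" by (rule keys_add)
    then show "lin_ext s f (p + q) = lin_ext s f p + lin_ext s f q"
      by (simp add: lin_ext_superset[OF assms, of ?X] lookup_add m.scale_left_distrib sum.distrib)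
    have "Poly_Mapping.keys (fscale c p) \<subseteq> Poly_Mapping.keys p"
      by (auto simp: in_keys_iff)
    then show "lin_ext s f (fscale c p) = s c (lin_ext s f p)"
      by (simp add: lin_ext_superset[OF assms, of "Poly_Mapping.keys p"] m.scale_sum_right)
  qed
qed

lemma lin_ext_basis [simp]:
  assumes "module s"
  shows "lin_ext s f (basis x) = f x"
proof -
  interpret m: module s by fact
  show ?thesis by (simp add: lin_ext_def basis_def)
qed

lemma lin_ext_basis_expansion: "lin_ext fscale basis p = p"
proof (rule poly_mapping_eqI)
  fix x
  have "Poly_Mapping.lookup (lin_ext fscale basis p) x =
      (\<Sum>y\<in>Poly_Mapping.keys p. if y = x then Poly_Mapping.lookup p y else 0)"
    unfolding lin_ext_def lookup_sum
    by (rule sum.cong) (auto simp: basis_def lookup_single when_def)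
  also have "\<dots> = Poly_Mapping.lookup p x"
    by (simp add: in_keys_iff)
  finally show "Poly_Mapping.lookup (lin_ext fscale basis p) x = Poly_Mapping.lookup p x" .
qed

lemma lin_ext_unique:
  assumes "module_hom fscale s h"
  shows "h = lin_ext s (\<lambda>x. h (basis x))"
proof
  fix p
  interpret h: module_hom fscale s h by fact
  have "h p = h (lin_ext fscale basis p)" by (simp add: lin_ext_basis_expansion)
  also have "\<dots> = lin_ext s (\<lambda>x. h (basis x)) p"
    by (simp add: lin_ext_def h.sum h.scale)
  finally show "h p = lin_ext s (\<lambda>x. h (basis x)) p" .
qed

lemma lin_ext_cong: "(\<And>x. f x = g x) \<Longrightarrow> lin_ext s f = lin_ext s g"
  by (rule arg_cong[of f g "lin_ext s"]) (rule ext)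

lemma lin_ext_fun_add:
  "lin_ext fscale (\<lambda>x. f x + g x) p = lin_ext fscale f p + lin_ext fscale g p"
proof -
  interpret module fscale by (rule module_fscale)
  show ?thesis by (simp add: lin_ext_def scale_right_distrib sum.distrib)
qed

lemma lin_ext_fun_scale:
  "lin_ext fscale (\<lambda>x. fscale c (f x)) p = fscale c (lin_ext fscale f p)"
proof -
  interpret module fscale by (rule module_fscale)
  show ?thesis by (simp add: lin_ext_def scale_sum_right mult.commute)
qed

lemma bilinear_map_bilin_ext: "bilinear_map fscale fscale fscale (bilin_ext f)"
  unfolding bilinear_map_def
proof (intro conjI allI)
  show "module_hom fscale fscale (bilin_ext f p)" for p
    unfolding bilin_ext_def module_hom_iff
    by (simp add: module_fscale lin_ext_fun_add lin_ext_fun_scale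
        module_hom.add[OF module_hom_lin_ext[OF module_fscale]]
        module_hom.scale[OF module_hom_lin_ext[OF module_fscale]])
  show "module_hom fscale fscale (\<lambda>p. bilin_ext f p q)" for q
    unfolding bilin_ext_def by (rule module_hom_lin_ext[OF module_fscale])
qed

lemma bilin_ext_basis [simp]: "bilin_ext f (basis x) (basis y) = f x y"
  by (simp add: bilin_ext_def module_fscale)

lemma bilinear_map_tensor: "bilinear_map fscale fscale fscale tensor"
  unfolding tensor_def using bilinear_map_bilin_ext .

lemma tensor_basis [simp]: "tensor (basis x) (basis y) = basis (x, y)"
  by (simp add: tensor_def)

lemma module_hom_tensor_lift:
  "module s \<Longrightarrow> module_hom fscale s (tensor_lift s f)"
  unfolding tensor_lift_def by (rule module_hom_lin_ext)

lemma module_hom_eqI: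
  assumes "module_hom fscale s g" "module_hom fscale s h"
    and "\<And>x. g (basis x) = h (basis x)"
  shows "g = h"
proof -
  have "g = lin_ext s (\<lambda>x. g (basis x))" by (rule lin_ext_unique) fact
  also have "\<dots> = lin_ext s (\<lambda>x. h (basis x))" by (rule lin_ext_cong) fact
  also have "\<dots> = h" by (rule lin_ext_unique[symmetric]) fact
  finally show ?thesis .
qed

lemma bilinear_map_eqI:
  assumes f: "bilinear_map fscale fscale s f" and g: "bilinear_map fscale fscale s g"
    and eq: "\<And>x y. f (basis x) (basis y) = g (basis x) (basis y)"
  shows "f p q = g p q"
proof -
  have "f (basis x) = g (basis x)" for x
    using f g eq by (intro module_hom_eqI[of s]) (auto simp: bilinear_map_def)
  then have "(\<lambda>p. f p q) = (\<lambda>p. g p q)"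
    using f g by (intro module_hom_eqI[of s]) (auto simp: bilinear_map_def)
  then show ?thesis by (rule fun_cong)
qed

lemma tensor_lift_tensor:
  fixes s :: "'a::comm_ring_1 \<Rightarrow> 'c::ab_group_add \<Rightarrow> 'c"
    and f :: "('b \<Rightarrow>\<^sub>0 'a) \<Rightarrow> ('d \<Rightarrow>\<^sub>0 'a) \<Rightarrow> 'c"
  assumes "bilinear_map fscale fscale s f"
  shows "tensor_lift s f (tensor p q) = f p q"
proof (rule bilinear_map_eqI[OF _ assms])
  have s: "module s"
    using assms by (auto simp: bilinear_map_def module_hom_iff)
  interpret L: module_hom fscale s "tensor_lift s f"
    by (rule module_hom_tensor_lift[OF s])
  have T: "bilinear_map (fscale :: 'a \<Rightarrow> ('b \<Rightarrow>\<^sub>0 'a) \<Rightarrow> _) fscale fscale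
      (tensor :: _ \<Rightarrow> ('d \<Rightarrow>\<^sub>0 'a) \<Rightarrow> _)"
    by (rule bilinear_map_tensor)
  show "bilinear_map fscale fscale s (\<lambda>p q. tensor_lift s f (tensor p q))"
    using T unfolding bilinear_map_def module_hom_iff
    by (simp add: L.add L.scale s)
  show "tensor_lift s f (tensor (basis x) (basis y)) = f (basis x) (basis y)" for x y
    by (simp add: tensor_lift_def s)
qed

theorem tensor_universal:
  assumes "bilinear_map fscale fscale s f"
  shows "\<exists>!h. module_hom fscale s h \<and> (\<forall>p q. h (tensor p q) = f p q)"
proof (rule ex1I[of _ "tensor_lift s f"])
  have s: "module s"
    using assms by (auto simp: bilinear_map_def module_hom_iff)
  show "module_hom fscale s (tensor_lift s f) \<and>
      (\<forall>p q. tensor_lift s f (tensor p q) = f p q)"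
    using s by (simp add: module_hom_tensor_lift tensor_lift_tensor[OF assms])
  fix h assume h: "module_hom fscale s h \<and> (\<forall>p q. h (tensor p q) = f p q)"
  have "h (basis xy) = (case xy of (x, y) \<Rightarrow> f (basis x) (basis y))" for xy
    using h by (cases xy) (simp flip: tensor_basis)
  then show "h = tensor_lift s f"
    using h s
    by (intro module_hom_eqI[of s])
      (auto simp: module_hom_lin_ext tensor_lift_def split: prod.splits)
qed


section \<open>Hopf algebras on free modules\<close>

locale free_algebra =
  fixes unit :: "'a \<Rightarrow>\<^sub>0 'k::comm_ring_1"
    and mult :: "('a \<Rightarrow>\<^sub>0 'k) \<Rightarrow> ('a \<Rightarrow>\<^sub>0 'k) \<Rightarrow> ('a \<Rightarrow>\<^sub>0 'k)"
  assumes mult_bilinear: "bilinear_map fscale fscale fscale mult"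
    and mult_assoc: "mult (mult x y) z = mult x (mult y z)"
    and mult_unit_left: "mult unit x = x"
    and mult_unit_right: "mult x unit = x"

locale free_coalgebra =
  fixes comult :: "('a \<Rightarrow>\<^sub>0 'k::comm_ring_1) \<Rightarrow> ('a \<times> 'a \<Rightarrow>\<^sub>0 'k)"
    and counit :: "('a \<Rightarrow>\<^sub>0 'k) \<Rightarrow> 'k"
  assumes comult_linear: "module_hom fscale fscale comult"
    and counit_linear: "module_hom fscale (*) counit"
    and comult_coassoc:
      "tensor_assoc (tensor_map comult id (comult x)) = tensor_map id comult (comult x)"
    and counit_left: "tensor_lift fscale (\<lambda>p q. fscale (counit p) q) (comult x) = x"
    and counit_right: "tensor_lift fscale (\<lambda>p q. fscale (counit q) p) (comult x) = x"

locale free_bialgebra = free_algebra unit mult + free_coalgebra comult counit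
  for unit :: "'a \<Rightarrow>\<^sub>0 'k::comm_ring_1"
    and mult :: "('a \<Rightarrow>\<^sub>0 'k) \<Rightarrow> ('a \<Rightarrow>\<^sub>0 'k) \<Rightarrow> ('a \<Rightarrow>\<^sub>0 'k)"
    and comult :: "('a \<Rightarrow>\<^sub>0 'k) \<Rightarrow> ('a \<times> 'a \<Rightarrow>\<^sub>0 'k)"
    and counit :: "('a \<Rightarrow>\<^sub>0 'k) \<Rightarrow> 'k" +
  assumes comult_unit: "comult unit = tensor unit unit"
    and comult_mult: "comult (mult x y) = tensor_mult mult (comult x) (comult y)"
    and counit_unit: "counit unit = 1"
    and counit_mult: "counit (mult x y) = counit x * counit y"

locale free_Hopf_algebra = free_bialgebra unit mult comult counit
  for unit :: "'a \<Rightarrow>\<^sub>0 'k::comm_ring_1"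
    and mult :: "('a \<Rightarrow>\<^sub>0 'k) \<Rightarrow> ('a \<Rightarrow>\<^sub>0 'k) \<Rightarrow> ('a \<Rightarrow>\<^sub>0 'k)"
    and comult :: "('a \<Rightarrow>\<^sub>0 'k) \<Rightarrow> ('a \<times> 'a \<Rightarrow>\<^sub>0 'k)"
    and counit :: "('a \<Rightarrow>\<^sub>0 'k) \<Rightarrow> 'k" +
  fixes antipode :: "('a \<Rightarrow>\<^sub>0 'k) \<Rightarrow> ('a \<Rightarrow>\<^sub>0 'k)"
  assumes antipode_linear: "module_hom fscale fscale antipode"
    and antipode_left:
      "tensor_lift fscale (\<lambda>p q. mult (antipode p) q) (comult x) = fscale (counit x) unit"
    and antipode_right:
      "tensor_lift fscale (\<lambda>p q. mult p (antipode q)) (comult x) = fscale (counit x) unit"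


section \<open>Planar binary trees with loops\<close>

datatype tree = Edge | Vee tree tree

text \<open>The order is the number of internal vertices; the leaves are numbered \<open>0, \<dots>, order t\<close>.\<close>

primrec order :: "tree \<Rightarrow> nat" where
  "order Edge = 0"
| "order (Vee t1 t2) = order t1 + order t2 + 1"

text \<open>
  A pair \<open>(t, S)\<close> is the tree \<open>t\<close> in which, for every \<open>i \<in> S\<close>, the leaves \<open>i\<close> and \<open>i + 1\<close>
  are joined by a loop.  The type contains the graphs of all orders and all numbers of loops.
\<close>

typedef lgraph = "{(t, S). S \<subseteq> {..<order t}}"
  by (rule exI[of _ "(Edge, {})"]) simp

setup_lifting type_definition_lgraph

lift_definition lorder :: "lgraph \<Rightarrow> nat" is "\<lambda>(t, S). order t" .

lift_definition edge :: lgraph is "(Edge, {})" by simp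

text \<open>
  \<open>graft False\<close> is the plain grafting; \<open>graft True\<close> also joins the last leaf of the
  left graph with the first leaf of the right graph by a loop.
\<close>

lift_definition graft :: "bool \<Rightarrow> lgraph \<Rightarrow> lgraph \<Rightarrow> lgraph" is
  "\<lambda>l (t1, S1) (t2, S2).
     (Vee t1 t2,
      S1 \<union> (if l then {order t1} else {}) \<union> (\<lambda>i. i + order t1 + 1) ` S2)"
  by (auto split: prod.splits if_splits simp: subset_iff)

lemma lorder_edge [simp]: "lorder edge = 0"
  by transfer simp

lemma lorder_graft [simp]: "lorder (graft l x y) = lorder x + lorder y + 1"
  by transfer auto

lemma edge_neq_graft [simp]: "edge \<noteq> graft l x y" "graft l x y \<noteq> edge"
  by (transfer; auto)+

lemma graft_inject [simp]:
  "graft l x y = graft l' x' y' \<longleftrightarrow> l = l' \<and> x = x' \<and> y = y'"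
proof
  have *: "l = l' \<and> S1 = S1' \<and> S2 = S2'"
    if S: "S1 \<subseteq> {..<n}" "S1' \<subseteq> {..<n}"
      and eq: "S1 \<union> (if l then {n} else {}) \<union> (\<lambda>i. i + n + 1) ` S2 =
        S1' \<union> (if l' then {n} else {}) \<union> (\<lambda>i. i + n + 1) ` S2'" (is "?A = ?B")
    for l l' n and S1 S1' S2 S2' :: "nat set"
  proof -
    have "S1 = ?A \<inter> {..<n}" "S1' = ?B \<inter> {..<n}"
      using S by (auto split: if_splits)
    moreover have "l \<longleftrightarrow> n \<in> ?A" "l' \<longleftrightarrow> n \<in> ?B"
      using S by (auto split: if_splits)
    moreover have "S2 = {i. i + n + 1 \<in> ?A}" "S2' = {i. i + n + 1 \<in> ?B}"
      using S by (auto split: if_splits)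
    ultimately show ?thesis unfolding eq by metis
  qed
  show "graft l x y = graft l' x' y' \<Longrightarrow> l = l' \<and> x = x' \<and> y = y'"
  proof -
    assume eq: "graft l x y = graft l' x' y'"
    obtain t1 S1 t2 S2 t1' S1' t2' S2' where
      R: "Rep_lgraph x = (t1, S1)" "Rep_lgraph y = (t2, S2)"
        "Rep_lgraph x' = (t1', S1')" "Rep_lgraph y' = (t2', S2')"
      by (metis surj_pair)
    have S: "S1 \<subseteq> {..<order t1}" "S1' \<subseteq> {..<order t1'}"
      using Rep_lgraph[of x] Rep_lgraph[of x'] R by auto
    have "Rep_lgraph (graft l x y) = Rep_lgraph (graft l' x' y')"
      using eq by simp
    then have t: "t1 = t1'" "t2 = t2'"
      and u: "S1 \<union> (if l then {order t1} else {}) \<union> (\<lambda>i. i + order t1 + 1) ` S2 =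
        S1' \<union> (if l' then {order t1'} else {}) \<union> (\<lambda>i. i + order t1' + 1) ` S2'"
      unfolding graft.rep_eq R prod.case prod.inject tree.inject by blast+
    have "l = l' \<and> S1 = S1' \<and> S2 = S2'"
      using S u unfolding t by (rule *)
    then show ?thesis
      using R t by (simp flip: Rep_lgraph_inject)
  qed
qed auto

lemma lgraph_exhaust [case_names edge graft]:
  obtains "x = edge" | l a b where "x = graft l a b"
proof (cases "Rep_lgraph x")
  case (Pair t S)
  then have S: "S \<subseteq> {..<order t}" using Rep_lgraph[of x] by auto
  show thesis
  proof (cases t)
    case Edge
    with Pair S have "x = edge" by (simp add: edge.rep_eq flip: Rep_lgraph_inject)
    then show thesis by (rule that)
  next
    case (Vee t1 t2)
    let ?n = "order t1"
    let ?S1 = "S \<inter> {..<?n}" and ?S2 = "{i. i + ?n + 1 \<in> S}" and ?l = "?n \<in> S"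
    have "S \<subseteq> ?S1 \<union> (if ?l then {?n} else {}) \<union> (\<lambda>i. i + ?n + 1) ` ?S2"
    proof
      fix i assume i: "i \<in> S"
      consider "i < ?n" | "i = ?n" | "i = (i - ?n - 1) + ?n + 1" by linarith
      then show "i \<in> ?S1 \<union> (if ?l then {?n} else {}) \<union> (\<lambda>i. i + ?n + 1) ` ?S2"
      proof cases
        case 3
        have *: "i - ?n - 1 \<in> ?S2" unfolding mem_Collect_eq 3[symmetric] by (rule i)
        show ?thesis
          by (rule UnI2, rule image_eqI[where x = "i - ?n - 1"], rule 3, rule *)
      qed (use i in auto)
    qed
    then have eq: "?S1 \<union> (if ?l then {?n} else {}) \<union> (\<lambda>i. i + ?n + 1) ` ?S2 = S"
      by (auto split: if_splits)
    have "?S2 \<subseteq> {..<order t2}" using S Vee by auto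
    then have "Rep_lgraph (Abs_lgraph (t1, ?S1)) = (t1, ?S1)"
      and "Rep_lgraph (Abs_lgraph (t2, ?S2)) = (t2, ?S2)"
      by (auto intro!: Abs_lgraph_inverse)
    then have "x = graft ?l (Abs_lgraph (t1, ?S1)) (Abs_lgraph (t2, ?S2))"
      unfolding Rep_lgraph_inject[symmetric] graft.rep_eq
      using eq by (simp only: Pair Vee prod.case)
    then show thesis by (rule that)
  qed
qed


section \<open>Product and co-product\<close>

definition graft_lin ::
  "bool \<Rightarrow> (lgraph \<Rightarrow>\<^sub>0 'k) \<Rightarrow> (lgraph \<Rightarrow>\<^sub>0 'k) \<Rightarrow> (lgraph \<Rightarrow>\<^sub>0 'k::comm_ring_1)" where
  "graft_lin l = bilin_ext (\<lambda>x y. basis (graft l x y))"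

function prod_graph :: "lgraph \<Rightarrow> lgraph \<Rightarrow> (lgraph \<Rightarrow>\<^sub>0 'k::comm_ring_1)" where
  "prod_graph x edge = basis x"
| "prod_graph edge (graft l y' y'') = basis (graft l y' y'')"
| "prod_graph (graft l1 x' x'') (graft l2 y' y'') =
     graft_lin l2 (prod_graph (graft l1 x' x'') y') (basis y'')
     + graft_lin l1 (basis x') (prod_graph x'' (graft l2 y' y''))"
proof goal_cases
  case (1 P xy)
  obtain x y where xy: "xy = (x, y)" by (cases xy)
  show ?case
    by (cases x rule: lgraph_exhaust; cases y rule: lgraph_exhaust) (use 1 xy in auto)
qed simp_all
termination
  by (relation "measure (\<lambda>(x, y). lorder x + lorder y)") auto

definition prod_h ::
  "(lgraph \<Rightarrow>\<^sub>0 'k) \<Rightarrow> (lgraph \<Rightarrow>\<^sub>0 'k) \<Rightarrow> (lgraph \<Rightarrow>\<^sub>0 'k::comm_ring_1)" where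
  "prod_h = bilin_ext prod_graph"

function coprod_graph :: "lgraph \<Rightarrow> (lgraph \<times> lgraph \<Rightarrow>\<^sub>0 'k::comm_ring_1)" where
  "coprod_graph edge = tensor (basis edge) (basis edge)"
| "coprod_graph (graft l a b) =
     tensor_lift fscale (\<lambda>a\<^sub>1 a\<^sub>2.
       tensor_lift fscale (\<lambda>b\<^sub>1 b\<^sub>2. tensor (prod_h a\<^sub>1 b\<^sub>1) (graft_lin l a\<^sub>2 b\<^sub>2))
         (coprod_graph b))
       (coprod_graph a)
     + tensor (basis (graft l a b)) (basis edge)"
proof goal_cases
  case (1 P x)
  then show ?case by (rule lgraph_exhaust[of x])
qed simp_all
termination
  by (relation "measure lorder") auto

definition coprod_h :: "(lgraph \<Rightarrow>\<^sub>0 'k) \<Rightarrow> (lgraph \<times> lgraph \<Rightarrow>\<^sub>0 'k::comm_ring_1)" where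
  "coprod_h = lin_ext fscale coprod_graph"

end

theory Submission
  imports Defs
begin

text \<open>
  Write \<open>a \<box> b\<close> for either grafting, \<open>*\<close> for the product, \<open>1\<close> for the edge and \<open>\<Delta>\<close> for the
  co-product.  The recursive definitions extend bilinearly to the two rules

    \<open>(a \<box> b) * (c \<box>' d) = ((a \<box> b) * c) \<box>' d + a \<box> (b * (c \<box>' d))\<close>,

    \<open>\<Delta> (a \<box> b) = \<Delta> a \<odot> \<Delta> b + (a \<box> b) \<otimes> 1\<close>,
    where \<open>(p \<otimes> q) \<odot> (p' \<otimes> q') = (p * p') \<otimes> (q \<box> q')\<close>,

  valid for arbitrary linear combinations \<open>a, b, c, d\<close> of graphs
  (\<open>prod_h_graft_lin\<close>, \<open>coprod_h_graft_lin\<close>; the operation \<open>\<odot>\<close> is \<open>coprod_graft\<close>).  With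
  these, the bialgebra axioms are structural inductions on graphs.

  Associativity: for grafts \<open>x = a \<box> b\<close>, \<open>y = c \<box>' d\<close>, \<open>z = e \<box>'' f\<close> both bracketings of
  \<open>x * y * z\<close> expand to the sum of \<open>(x * y * e) \<box>'' f\<close>,
  \<open>(x * c) \<box>' (d * z)\<close> and \<open>a \<box> (b * y * z)\<close>, by the induction hypotheses for \<open>(x, y, e)\<close> and
  \<open>(b, y, z)\<close>.

  Multiplicativity of \<open>\<Delta>\<close>: once associativity is known, \<open>\<odot>\<close> satisfies the first rule for the
  product of the tensor square (\<open>tensor_mult_coprod_graft\<close>), and multiplication by a tensor
  \<open>p \<otimes> 1\<close> slides into one argument of \<open>\<odot>\<close>.  Hence \<open>\<Delta> x * \<Delta> y\<close> expands like \<open>x * y\<close>, and the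
  induction hypotheses for \<open>(x, c)\<close> and \<open>(b, y)\<close> finish the comparison.

  Co-associativity: \<open>\<Delta> \<otimes> id\<close> turns \<open>\<odot>\<close> into the analogous operation on triple tensors,
  because \<open>\<Delta>\<close> is multiplicative, and so does \<open>id \<otimes> \<Delta>\<close> up to the term \<open>(\<Delta> a \<odot> \<Delta> b) \<otimes> 1\<close>,
  which occurs in \<open>\<Delta> (a \<box> b) \<otimes> 1\<close> on the other side.  The counit is the coefficient of the edge: it kills
  all grafts, which gives its axioms at once.

  Antipode: the product adds orders, so \<open>\<Delta> x - x \<otimes> 1\<close> involves only left factors of order
  smaller than that of \<open>x\<close>.  In any bialgebra with such a filtration the equation for a left
  antipode can be solved recursively, and the solution is also a right antipode because
  convolution with the identity is cancellable (locale \<open>filtered_bialgebra\<close>).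
\<close>

section \<open>Multilinear algebra on free modules\<close>

text \<open>
  Multilinear maps are evaluated on pure tensors, so pure tensors of basis elements must not
  be rewritten to basis elements of the tensor product.
\<close>

declare tensor_basis [simp del]

text \<open>
  Together with the rules for sums and multiples of a multilinear operation, this reduces
  every multilinear identity to basis elements.
\<close>

lemma free_module_induct [case_names basis add scale]:
  fixes p :: "'a \<Rightarrow>\<^sub>0 'k::comm_ring_1"
  assumes "\<And>x. P (basis x)" and "\<And>p q. P p \<Longrightarrow> P q \<Longrightarrow> P (p + q)"
    and scale: "\<And>c p. P p \<Longrightarrow> P (fscale c p)"
  shows "P p"
proof -
  interpret module "fscale :: 'k \<Rightarrow> ('a \<Rightarrow>\<^sub>0 'k) \<Rightarrow> _" by (rule module_fscale)
  have zero: "P 0" using scale[of "basis undefined" 0] assms(1) by simp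
  have "P (\<Sum>x\<in>X. fscale (Poly_Mapping.lookup p x) (basis x))" if "finite X" for X
    using that by induction (auto intro: assms zero)
  from this[of "Poly_Mapping.keys p"] show ?thesis
    using lin_ext_basis_expansion[of p] by (simp add: lin_ext_def)
qed

lemma bilinear_map_simps:
  fixes f :: "('a \<Rightarrow>\<^sub>0 'k::comm_ring_1) \<Rightarrow> ('b \<Rightarrow>\<^sub>0 'k) \<Rightarrow> ('c \<Rightarrow>\<^sub>0 'k)"
  assumes "bilinear_map fscale fscale fscale f"
  shows "f (p + p') q = f p q + f p' q" "f p (q + q') = f p q + f p q'"
    "f (fscale c p) q = fscale c (f p q)" "f p (fscale c q) = fscale c (f p q)"
    "f 0 q = 0" "f p 0 = 0"
proof -
  interpret R: module_hom fscale fscale "f p" for p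
    using assms by (auto simp: bilinear_map_def)
  interpret L: module_hom fscale fscale "\<lambda>p. f p q" for q
    using assms by (auto simp: bilinear_map_def)
  show "f (p + p') q = f p q + f p' q" "f p (q + q') = f p q + f p q'"
    "f (fscale c p) q = fscale c (f p q)" "f p (fscale c q) = fscale c (f p q)"
    "f 0 q = 0" "f p 0 = 0"
    by (rule L.add R.add L.scale R.scale L.zero R.zero)+
qed

lemma id_linear: "module_hom fscale fscale (\<lambda>p :: 'a \<Rightarrow>\<^sub>0 'k::comm_ring_1. p)"
  by (simp add: module_hom_iff module_fscale)

lemma bilinear_mapI:
  fixes f :: "('a \<Rightarrow>\<^sub>0 'k::comm_ring_1) \<Rightarrow> ('b \<Rightarrow>\<^sub>0 'k) \<Rightarrow> ('c \<Rightarrow>\<^sub>0 'k)"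
  assumes "\<And>p p' q. f (p + p') q = f p q + f p' q" "\<And>p q q'. f p (q + q') = f p q + f p q'"
    "\<And>c p q. f (fscale c p) q = fscale c (f p q)" "\<And>c p q. f p (fscale c q) = fscale c (f p q)"
  shows "bilinear_map fscale fscale fscale f"
  using assms by (simp add: bilinear_map_def module_hom_iff module_fscale)

lemma module_homI:
  fixes f :: "('a \<Rightarrow>\<^sub>0 'k::comm_ring_1) \<Rightarrow> ('b \<Rightarrow>\<^sub>0 'k)"
  assumes "\<And>p q. f (p + q) = f p + f q" "\<And>c p. f (fscale c p) = fscale c (f p)"
  shows "module_hom fscale fscale f"
  using assms by (simp add: module_hom_iff module_fscale)

lemma fscale_simps:
  "fscale c (p + q) = fscale c p + fscale c q" "fscale c (fscale d p) = fscale (c * d) p"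
  "fscale 1 p = p" "fscale 0 p = 0" "fscale (c + d) p = fscale c p + fscale d p"
  by (rule poly_mapping_eqI, simp add: lookup_add algebra_simps)+

lemmas tensor_simps = bilinear_map_simps[OF bilinear_map_tensor]

text \<open>
  A scalar multiple of a pure tensor is again a pure tensor, so the pure tensors span the
  tensor product additively.
\<close>

lemma tensor_induct [case_names tensor add]:
  fixes u :: "'a \<times> 'b \<Rightarrow>\<^sub>0 'k::comm_ring_1"
  assumes "\<And>p q. P (tensor p q)" and "\<And>u v. P u \<Longrightarrow> P v \<Longrightarrow> P (u + v)"
  shows "P u"
proof -
  have "P (fscale c u)" for c
  proof (induction u arbitrary: c rule: free_module_induct)
    case (basis xy)
    show ?case
      using assms(1)[of "fscale c (basis (fst xy))" "basis (snd xy)"] by (simp add: tensor_simps tensor_basis)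
  qed (simp_all add: fscale_simps assms(2))
  from this[of 1] show ?thesis by (simp add: fscale_simps)
qed

lemma lin_ext_simps:
  "lin_ext fscale f (p + q) = lin_ext fscale f p + lin_ext fscale f q"
  "lin_ext fscale f (fscale c p) = fscale c (lin_ext fscale f p)"
  using module_hom.add[OF module_hom_lin_ext[OF module_fscale, of f]]
    module_hom.scale[OF module_hom_lin_ext[OF module_fscale, of f]] by auto

lemma tensor_lift_simps:
  "tensor_lift fscale f (u + v) = tensor_lift fscale f u + tensor_lift fscale f v"
  "tensor_lift fscale f (fscale c u) = fscale c (tensor_lift fscale f u)"
  by (simp_all add: tensor_lift_def lin_ext_simps)

lemma tensor_lift_fun_simps:
  "tensor_lift fscale (\<lambda>p q. f p q + g p q) u = tensor_lift fscale f u + tensor_lift fscale g u"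
  "tensor_lift fscale (\<lambda>p q. fscale c (f p q)) u = fscale c (tensor_lift fscale f u)"
  by (simp_all add: tensor_lift_def case_prod_beta' lin_ext_fun_add lin_ext_fun_scale)

lemma tensor_map_simps:
  "tensor_map f g (u + v) = tensor_map f g u + tensor_map f g v"
  "tensor_map f g (fscale c u) = fscale c (tensor_map f g u)"
  by (simp_all add: tensor_map_def tensor_lift_simps)

lemma tensor_map_tensor:
  assumes "module_hom fscale fscale f" "module_hom fscale fscale g"
  shows "tensor_map f g (tensor p q) = tensor (f p) (g q)"
  using assms unfolding tensor_map_def
  by (intro tensor_lift_tensor bilinear_mapI)
    (simp_all add: module_hom.add module_hom.scale tensor_simps)

lemma tensor_assoc_simps:
  "tensor_assoc (u + v) = tensor_assoc u + tensor_assoc v"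
  "tensor_assoc (fscale c u) = fscale c (tensor_assoc u)"
  by (simp_all add: tensor_assoc_def tensor_lift_simps)

lemma tensor_assoc_tensor:
  "tensor_assoc (tensor (tensor p q) r) = tensor p (tensor q r)"
proof -
  have "tensor_assoc (tensor (tensor p q) r) =
      tensor_lift fscale (\<lambda>p q. tensor p (tensor q r)) (tensor p q)"
    unfolding tensor_assoc_def
    by (intro tensor_lift_tensor bilinear_mapI)
      (simp_all add: tensor_lift_simps tensor_simps tensor_lift_fun_simps)
  also have "\<dots> = tensor p (tensor q r)"
    by (intro tensor_lift_tensor bilinear_mapI) (simp_all add: tensor_simps)
  finally show ?thesis .
qed

text \<open>
  The operation \<open>(p \<otimes> q, p' \<otimes> q') \<mapsto> f p p' \<otimes> g q q'\<close>.  The product on a tensor square is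
  the case \<open>f = g\<close>; the co-product of a graft is a case in which \<open>f\<close> is the product and \<open>g\<close> a
  grafting, and co-associativity leads to a case in which \<open>g\<close> is itself such an operation.
\<close>

definition tensor_op ::
  "(('a \<Rightarrow>\<^sub>0 'k) \<Rightarrow> ('b \<Rightarrow>\<^sub>0 'k) \<Rightarrow> ('c \<Rightarrow>\<^sub>0 'k)) \<Rightarrow>
   (('d \<Rightarrow>\<^sub>0 'k) \<Rightarrow> ('e \<Rightarrow>\<^sub>0 'k) \<Rightarrow> ('f \<Rightarrow>\<^sub>0 'k)) \<Rightarrow>
   ('a \<times> 'd \<Rightarrow>\<^sub>0 'k) \<Rightarrow> ('b \<times> 'e \<Rightarrow>\<^sub>0 'k) \<Rightarrow> ('c \<times> 'f \<Rightarrow>\<^sub>0 'k::comm_ring_1)" where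
  "tensor_op f g u v =
     tensor_lift fscale (\<lambda>p q. tensor_lift fscale (\<lambda>p' q'. tensor (f p p') (g q q')) v) u"

lemma tensor_mult_eq_tensor_op: "tensor_mult m = tensor_op m m"
  by (intro ext) (simp add: tensor_mult_def tensor_op_def)

lemma bilinear_map_tensor_op: "bilinear_map fscale fscale fscale (tensor_op f g)"
  unfolding tensor_op_def
  by (intro bilinear_mapI) (simp_all add: tensor_lift_simps tensor_lift_fun_simps)

lemmas tensor_op_simps = bilinear_map_simps[OF bilinear_map_tensor_op]

lemma tensor_op_tensor:
  assumes f: "bilinear_map fscale fscale fscale f" and g: "bilinear_map fscale fscale fscale g"
  shows "tensor_op f g (tensor p q) (tensor p' q') = tensor (f p p') (g q q')"
proof -
  note fg = bilinear_map_simps[OF f] bilinear_map_simps[OF g]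
  have "tensor_op f g (tensor p q) (tensor p' q') =
      tensor_lift fscale (\<lambda>p' q'. tensor (f p p') (g q q')) (tensor p' q')"
    unfolding tensor_op_def
    by (intro tensor_lift_tensor bilinear_mapI)
      (simp_all add: tensor_simps fg tensor_lift_fun_simps)
  also have "\<dots> = tensor (f p p') (g q q')"
    by (intro tensor_lift_tensor bilinear_mapI) (simp_all add: tensor_simps fg)
  finally show ?thesis .
qed


section \<open>Antipodes of filtered bialgebras\<close>

text \<open>
  The condition says that \<open>\<Delta> x = x \<otimes> 1 + R x\<close>, where all left factors of \<open>R x\<close> have smaller
  degree than \<open>x\<close>.  For the convolution \<open>(f \<star> g) x = \<Sum> f (x\<^sub>1) g (x\<^sub>2)\<close>, an equation
  \<open>f \<star> id = h\<close> then reads \<open>f x = h x - \<Sum> f (R\<^sub>1) R\<^sub>2\<close> and determines \<open>f\<close> by recursion on the degree.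
\<close>

locale filtered_bialgebra = free_bialgebra unit mult comult counit
  for unit :: "'a \<Rightarrow>\<^sub>0 'k::comm_ring_1"
    and mult :: "('a \<Rightarrow>\<^sub>0 'k) \<Rightarrow> ('a \<Rightarrow>\<^sub>0 'k) \<Rightarrow> ('a \<Rightarrow>\<^sub>0 'k)"
    and comult :: "('a \<Rightarrow>\<^sub>0 'k) \<Rightarrow> ('a \<times> 'a \<Rightarrow>\<^sub>0 'k)"
    and counit :: "('a \<Rightarrow>\<^sub>0 'k) \<Rightarrow> 'k" +
  fixes degree :: "'a \<Rightarrow> nat"
  assumes degree_less:
    "pq \<in> Poly_Mapping.keys (comult (basis x) - tensor (basis x) unit) \<Longrightarrow>
     degree (fst pq) < degree x"
begin

definition reduced_comult :: "'a \<Rightarrow> ('a \<times> 'a \<Rightarrow>\<^sub>0 'k)" where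
  "reduced_comult x = comult (basis x) - tensor (basis x) unit"

lemma comult_basis: "comult (basis x) = tensor (basis x) unit + reduced_comult x"
  by (simp add: reduced_comult_def)

lemma degree_reduced_comult:
  "pq \<in> Poly_Mapping.keys (reduced_comult x) \<Longrightarrow> degree (fst pq) < degree x"
  unfolding reduced_comult_def by (rule degree_less)

lemmas mult_simps = bilinear_map_simps[OF mult_bilinear]

lemma convolution_lift_tensor:
  assumes "module_hom fscale fscale f" "module_hom fscale fscale g"
  shows "tensor_lift fscale (\<lambda>p q. mult (f p) (g q)) (tensor p q) = mult (f p) (g q)"
  using assms
  by (intro tensor_lift_tensor bilinear_mapI)
    (simp_all add: mult_simps module_hom.add module_hom.scale)

lemma convolution_basis:
  assumes f: "module_hom fscale fscale f"
  shows "tensor_lift fscale (\<lambda>p q. mult (f p) q) (comult (basis x)) = f (basis x) +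
    (\<Sum>pq\<in>Poly_Mapping.keys (reduced_comult x).
      fscale (Poly_Mapping.lookup (reduced_comult x) pq)
        (mult (f (basis (fst pq))) (basis (snd pq))))"
  unfolding comult_basis tensor_lift_simps convolution_lift_tensor[OF f id_linear]
  by (simp add: mult_unit_right tensor_lift_def lin_ext_def case_prod_beta)

text \<open>
  In \<open>(f \<star> id) x = f x + \<Sum> f (R\<^sub>1) R\<^sub>2\<close> the sum is known from smaller degrees, so
  \<open>f \<star> id\<close> determines \<open>f\<close>.
\<close>

lemma convolution_id_cancel:
  assumes f: "module_hom fscale fscale f" and g: "module_hom fscale fscale g"
    and eq: "\<And>x. tensor_lift fscale (\<lambda>p q. mult (f p) q) (comult x) =
      tensor_lift fscale (\<lambda>p q. mult (g p) q) (comult x)"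
  shows "f = g"
proof (rule module_hom_eqI[OF f g])
  show "f (basis x) = g (basis x)" for x
  proof (induction "degree x" arbitrary: x rule: less_induct)
    case less
    have "f (basis (fst pq)) = g (basis (fst pq))"
      if "pq \<in> Poly_Mapping.keys (reduced_comult x)" for pq
      using less[OF degree_reduced_comult[OF that]] .
    with eq[of "basis x"] show ?case
      unfolding convolution_basis[OF f] convolution_basis[OF g] by simp
  qed
qed

text \<open>
  The solution of \<open>S \<star> id = \<eta> \<epsilon>\<close>, the composite of the counit \<open>\<epsilon>\<close> and the unit \<open>\<eta>\<close>.
\<close>

function antipode_basis :: "'a \<Rightarrow> ('a \<Rightarrow>\<^sub>0 'k)" where
  "antipode_basis x = fscale (counit (basis x)) unit -
    (\<Sum>pq\<in>Poly_Mapping.keys (reduced_comult x).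
      fscale (Poly_Mapping.lookup (reduced_comult x) pq)
        (mult (antipode_basis (fst pq)) (basis (snd pq))))"
  by auto
termination
  by (relation "measure degree") (auto dest: degree_reduced_comult)

declare antipode_basis.simps [simp del]

definition antipode :: "('a \<Rightarrow>\<^sub>0 'k) \<Rightarrow> ('a \<Rightarrow>\<^sub>0 'k)" where
  "antipode = lin_ext fscale antipode_basis"

lemma antipode_linear: "module_hom fscale fscale antipode"
  unfolding antipode_def by (rule module_hom_lin_ext[OF module_fscale])

lemma unit_counit_linear: "module_hom fscale fscale (\<lambda>x. fscale (counit x) unit)"
  using counit_linear
  by (intro module_homI) (simp_all add: module_hom.add module_hom.scale fscale_simps)

lemma antipode_left:
  "tensor_lift fscale (\<lambda>p q. mult (antipode p) q) (comult x) = fscale (counit x) unit"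
proof -
  have "(\<lambda>x. tensor_lift fscale (\<lambda>p q. mult (antipode p) q) (comult x)) =
      (\<lambda>x. fscale (counit x) unit)"
  proof (rule module_hom_eqI[OF _ unit_counit_linear])
    show "module_hom fscale fscale (\<lambda>x. tensor_lift fscale (\<lambda>p q. mult (antipode p) q) (comult x))"
      using comult_linear
      by (intro module_homI) (simp_all add: module_hom.add module_hom.scale tensor_lift_simps)
    have "antipode (basis x) = antipode_basis x" for x
      by (simp add: antipode_def module_fscale)
    then show "tensor_lift fscale (\<lambda>p q. mult (antipode p) q) (comult (basis x)) =
        fscale (counit (basis x)) unit" for x
      unfolding convolution_basis[OF antipode_linear]
      by (simp add: antipode_basis.simps[of x])
  qed
  then show ?thesis by (rule fun_cong)
qed

text \<open>
  Let \<open>f = id \<star> S\<close>.  Associativity of convolution and \<open>S \<star> id = \<eta> \<epsilon>\<close> give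
  \<open>f \<star> id = id \<star> (S \<star> id) = id \<star> \<eta> \<epsilon> = id = \<eta> \<epsilon> \<star> id\<close>, and \<open>id\<close> can be cancelled.
  Associativity is obtained by routing both bracketings through the map
  \<open>p \<otimes> (q \<otimes> r) \<mapsto> p S(q) r\<close> on triple tensors, called \<open>triple\<close>.
\<close>

lemma antipode_right:
  "tensor_lift fscale (\<lambda>p q. mult p (antipode q)) (comult x) = fscale (counit x) unit"
proof -
  define f where "f x = tensor_lift fscale (\<lambda>p q. mult p (antipode q)) (comult x)" for x
  define triple where "triple =
    tensor_lift fscale (\<lambda>p t. mult p (tensor_lift fscale (\<lambda>q r. mult (antipode q) r) t))"
  note comult_simps = module_hom.add[OF comult_linear] module_hom.scale[OF comult_linear]
  note counit_simps = module_hom.add[OF counit_linear] module_hom.scale[OF counit_linear]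
  have f: "module_hom fscale fscale f"
    unfolding f_def by (intro module_homI) (simp_all add: comult_simps tensor_lift_simps)
  note f_simps = module_hom.add[OF f] module_hom.scale[OF f]
  have triple_add: "triple (u + v) = triple u + triple v" for u v
    by (simp add: triple_def tensor_lift_simps)
  have triple_tensor:
    "triple (tensor p t) = mult p (tensor_lift fscale (\<lambda>q r. mult (antipode q) r) t)" for p t
    unfolding triple_def
    by (intro tensor_lift_tensor bilinear_mapI) (simp_all add: mult_simps tensor_lift_simps)
  have left: "tensor_lift fscale (\<lambda>p q. mult (f p) q) u =
      triple (tensor_assoc (tensor_map comult id u))" for u
  proof (induction u rule: tensor_induct)
    case (tensor p q)
    have "mult (tensor_lift fscale (\<lambda>p q. mult p (antipode q)) s) q =
        triple (tensor_assoc (tensor s q))" for s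
      by (induction s rule: tensor_induct)
        (simp_all add: tensor_lift_simps mult_simps tensor_simps tensor_assoc_simps triple_add
          convolution_lift_tensor[OF id_linear antipode_linear]
          convolution_lift_tensor[OF antipode_linear id_linear]
          tensor_assoc_tensor triple_tensor mult_assoc)
    from this[of "comult p", folded f_def] show ?case
      by (simp add: convolution_lift_tensor[OF f id_linear]
          tensor_map_tensor[OF comult_linear id_linear])
  qed (simp add: tensor_lift_simps tensor_map_simps tensor_assoc_simps triple_add)
  have right: "triple (tensor_map id comult u) =
      tensor_lift fscale (\<lambda>p q. fscale (counit q) p) u" for u
  proof (induction u rule: tensor_induct)
    case (tensor p q)
    have "tensor_lift fscale (\<lambda>p q. fscale (counit q) p) (tensor p q) = fscale (counit q) p"
      by (intro tensor_lift_tensor bilinear_mapI)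
        (simp_all add: counit_simps fscale_simps mult.commute)
    then show ?case
      by (simp add: tensor_map_tensor[OF id_linear comult_linear] triple_tensor antipode_left
          mult_simps mult_unit_right)
  qed (simp add: tensor_lift_simps tensor_map_simps triple_add)
  have "f = (\<lambda>x. fscale (counit x) unit)"
  proof (rule convolution_id_cancel[OF f unit_counit_linear])
    fix x
    have "tensor_lift fscale (\<lambda>p q. mult (fscale (counit p) unit) q) (comult x) = x"
      using counit_left[of x] by (simp add: mult_simps mult_unit_left)
    then show "tensor_lift fscale (\<lambda>p q. mult (f p) q) (comult x) =
        tensor_lift fscale (\<lambda>p q. mult (fscale (counit p) unit) q) (comult x)"
      by (simp add: left comult_coassoc right counit_right)
  qed
  then show ?thesis by (simp add: f_def fun_eq_iff)
qed

theorem free_Hopf_algebra_antipode: "free_Hopf_algebra unit mult comult counit antipode"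
  by (intro free_Hopf_algebra.intro free_Hopf_algebra_axioms.intro free_bialgebra_axioms
      antipode_linear antipode_left antipode_right)

end


section \<open>The algebra of trees with loops\<close>

lemma lgraph_induct [case_names edge graft]:
  assumes "P edge" and "\<And>l a b. P a \<Longrightarrow> P b \<Longrightarrow> P (graft l a b)"
  shows "P x"
proof (induction "lorder x" arbitrary: x rule: less_induct)
  case less
  then show ?case by (cases x rule: lgraph_exhaust) (auto intro: assms)
qed

lemma bilinear_map_prod_h: "bilinear_map fscale fscale fscale prod_h"
  unfolding prod_h_def by (rule bilinear_map_bilin_ext)

lemma bilinear_map_graft_lin: "bilinear_map fscale fscale fscale (graft_lin l)"
  unfolding graft_lin_def by (rule bilinear_map_bilin_ext)

lemmas prod_h_simps = bilinear_map_simps[OF bilinear_map_prod_h]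

lemmas graft_lin_simps = bilinear_map_simps[OF bilinear_map_graft_lin]

lemma prod_h_basis: "prod_h (basis x) (basis y) = prod_graph x y"
  by (simp add: prod_h_def)

lemma basis_graft: "basis (graft l x y) = graft_lin l (basis x) (basis y)"
  by (simp add: graft_lin_def)

lemma prod_h_edge [simp]: "prod_h (basis edge) p = p" "prod_h p (basis edge) = p"
proof -
  have edge: "prod_h (basis edge) (basis x) = basis x" for x
    by (cases x rule: lgraph_exhaust) (simp_all add: prod_h_basis)
  show "prod_h (basis edge) p = p"
    by (induction p rule: free_module_induct) (simp_all add: prod_h_simps edge)
  show "prod_h p (basis edge) = p"
    by (induction p rule: free_module_induct) (simp_all add: prod_h_simps prod_h_basis)
qed

lemma prod_h_graft_lin:
  "prod_h (graft_lin l a b) (graft_lin m c d) =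
     graft_lin m (prod_h (graft_lin l a b) c) d + graft_lin l a (prod_h b (graft_lin m c d))"
proof (induction a rule: free_module_induct)
  case a: (basis x')
  show ?case
  proof (induction b rule: free_module_induct)
    case b: (basis x'')
    show ?case
    proof (induction c rule: free_module_induct)
      case c: (basis y')
      show ?case
      proof (induction d rule: free_module_induct)
        case d: (basis y'')
        show ?case by (simp add: prod_h_basis flip: basis_graft)
      qed (simp_all add: graft_lin_simps prod_h_simps fscale_simps)
    qed (simp_all add: graft_lin_simps prod_h_simps fscale_simps)
  qed (simp_all add: graft_lin_simps prod_h_simps fscale_simps)
qed (simp_all add: graft_lin_simps prod_h_simps fscale_simps)

text \<open>
  The induction on \<open>x\<close> is for all \<open>y\<close> and \<open>z\<close>, and the one on \<open>z\<close> keeps \<open>x\<close> and \<open>y\<close>: the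
  outer one serves \<open>(x'', y, z)\<close> and the inner one \<open>(x, y, z')\<close>.  The graph \<open>y\<close> never gets
  smaller.
\<close>

lemma prod_h_assoc_basis:
  "prod_h (prod_h (basis x) (basis y :: lgraph \<Rightarrow>\<^sub>0 'k::comm_ring_1)) (basis z) = prod_h (basis x) (prod_h (basis y) (basis z))"
proof (induction x arbitrary: y z rule: lgraph_induct)
  case (graft l x' x'')
  note IH_x'' = graft.IH(2)
  show ?case
  proof (induction z rule: lgraph_induct)
    case (graft n z' z'')
    show ?case
    proof (cases y rule: lgraph_exhaust)
      case y: (graft m y' y'')
      let ?X = "graft_lin l (basis x') (basis x'') :: lgraph \<Rightarrow>\<^sub>0 'k"
      let ?Y = "graft_lin m (basis y') (basis y'') :: lgraph \<Rightarrow>\<^sub>0 'k"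
      let ?Z = "graft_lin n (basis z') (basis z'') :: lgraph \<Rightarrow>\<^sub>0 'k"
      have IH1: "prod_h (prod_h ?X ?Y) (basis z') = prod_h ?X (prod_h ?Y (basis z'))"
        using graft.IH(1) by (simp add: y basis_graft)
      have IH2: "prod_h (prod_h (basis x'') ?Y) ?Z = prod_h (basis x'') (prod_h ?Y ?Z)"
        using IH_x''[of y "graft n z' z''"]
        by (simp add: y basis_graft)
      have "prod_h (prod_h ?X ?Y) ?Z =
          graft_lin n (prod_h (prod_h ?X ?Y) (basis z')) (basis z'')
          + graft_lin m (prod_h ?X (basis y')) (prod_h (basis y'') ?Z)
          + graft_lin l (basis x') (prod_h (prod_h (basis x'') ?Y) ?Z)"
        by (simp add: prod_h_graft_lin prod_h_simps graft_lin_simps)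
      also have "\<dots> = prod_h ?X (prod_h ?Y ?Z)"
        unfolding IH1 IH2 by (simp add: prod_h_graft_lin prod_h_simps graft_lin_simps)
      finally show ?thesis by (simp add: y basis_graft)
    qed simp
  qed simp
qed simp

lemma prod_h_assoc: "prod_h (prod_h p q) r = prod_h p (prod_h q r)"
proof (induction p rule: free_module_induct)
  case p: (basis x)
  show ?case
  proof (induction q rule: free_module_induct)
    case q: (basis y)
    show ?case
      by (induction r rule: free_module_induct) (simp_all add: prod_h_simps prod_h_assoc_basis)
  qed (simp_all add: prod_h_simps)
qed (simp_all add: prod_h_simps)

interpretation trees: free_algebra "basis edge :: lgraph \<Rightarrow>\<^sub>0 'k::comm_ring_1" prod_h
  by unfold_locales (simp_all add: bilinear_map_prod_h prod_h_assoc)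


section \<open>The co-product is multiplicative and co-associative\<close>

definition coprod_graft ::
  "bool \<Rightarrow> (lgraph \<times> lgraph \<Rightarrow>\<^sub>0 'k) \<Rightarrow> (lgraph \<times> lgraph \<Rightarrow>\<^sub>0 'k) \<Rightarrow>
   (lgraph \<times> lgraph \<Rightarrow>\<^sub>0 'k::comm_ring_1)" where
  "coprod_graft l = tensor_op prod_h (graft_lin l)"

lemma coprod_h_simps:
  "coprod_h (p + q) = coprod_h p + coprod_h q" "coprod_h (fscale c p) = fscale c (coprod_h p)"
  by (simp_all add: coprod_h_def lin_ext_simps)

lemma coprod_h_linear: "module_hom fscale fscale coprod_h"
  by (intro module_homI) (simp_all add: coprod_h_simps)

lemma coprod_h_basis: "coprod_h (basis x) = coprod_graph x"
  by (simp add: coprod_h_def module_fscale)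

lemma coprod_h_edge: "coprod_h (basis edge) = tensor (basis edge) (basis edge)"
  by (simp add: coprod_h_basis)

lemma bilinear_map_coprod_graft: "bilinear_map fscale fscale fscale (coprod_graft l)"
  unfolding coprod_graft_def by (rule bilinear_map_tensor_op)

lemmas coprod_graft_simps = bilinear_map_simps[OF bilinear_map_coprod_graft]

lemma coprod_graft_tensor:
  "coprod_graft l (tensor p q) (tensor p' q') = tensor (prod_h p p') (graft_lin l q q')"
  by (simp add: coprod_graft_def tensor_op_tensor bilinear_map_prod_h bilinear_map_graft_lin)

text \<open>
  The product of two graphs is a sum of grafts in which one operand is itself a product, hence
  not a single graph; so the recursion for the co-product is needed for linear combinations.
\<close>

lemma coprod_h_graft_lin:
  "coprod_h (graft_lin l p q) =
     coprod_graft l (coprod_h p) (coprod_h q) + tensor (graft_lin l p q) (basis edge)"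
proof (induction p rule: free_module_induct)
  case p: (basis x)
  show ?case
  proof (induction q rule: free_module_induct)
    case q: (basis y)
    show ?case
      by (simp add: coprod_h_basis coprod_graft_def tensor_op_def flip: basis_graft)
  qed (simp_all add: graft_lin_simps coprod_h_simps coprod_graft_simps tensor_simps fscale_simps)
qed (simp_all add: graft_lin_simps coprod_h_simps coprod_graft_simps tensor_simps fscale_simps)

lemma tensor_mult_tensor:
  "tensor_mult prod_h (tensor p q) (tensor p' q') = tensor (prod_h p p') (prod_h q q')"
  by (simp add: tensor_mult_eq_tensor_op tensor_op_tensor bilinear_map_prod_h)

lemmas tensor_mult_simps =
  tensor_op_simps[where f = prod_h and g = prod_h, folded tensor_mult_eq_tensor_op]

text \<open>
  On pure tensors this is the rule for the product of two grafts in the right factors; in the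
  left factors every term has the product of the same four elements, differently bracketed.
\<close>

lemma tensor_mult_coprod_graft:
  "tensor_mult prod_h (coprod_graft l s t) (coprod_graft m u v) =
     coprod_graft m (tensor_mult prod_h (coprod_graft l s t) u) v
     + coprod_graft l s (tensor_mult prod_h t (coprod_graft m u v))"
proof (induction s rule: tensor_induct)
  case s: (tensor s1 s2)
  show ?case
  proof (induction t rule: tensor_induct)
    case t: (tensor t1 t2)
    show ?case
    proof (induction u rule: tensor_induct)
      case u: (tensor u1 u2)
      show ?case
        by (induction v rule: tensor_induct)
          (simp_all add: coprod_graft_tensor tensor_mult_tensor prod_h_graft_lin tensor_simps
            prod_h_assoc coprod_graft_simps tensor_mult_simps)
    qed (simp_all add: coprod_graft_simps tensor_mult_simps)
  qed (simp_all add: coprod_graft_simps tensor_mult_simps)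
qed (simp_all add: coprod_graft_simps tensor_mult_simps)

text \<open>
  In the right factor, multiplying by the edge does nothing, so \<open>p\<close> may be moved across the
  graft by associativity in the left factor.
\<close>

lemma tensor_mult_coprod_graft_left:
  "tensor_mult prod_h (coprod_graft l s t) (tensor p (basis edge)) =
     coprod_graft l s (tensor_mult prod_h t (tensor p (basis edge)))"
proof (induction s rule: tensor_induct)
  case s: (tensor s1 s2)
  show ?case
    by (induction t rule: tensor_induct)
      (simp_all add: coprod_graft_tensor tensor_mult_tensor prod_h_assoc coprod_graft_simps
        tensor_mult_simps)
qed (simp_all add: coprod_graft_simps tensor_mult_simps)

lemma tensor_mult_coprod_graft_right:
  "tensor_mult prod_h (tensor p (basis edge)) (coprod_graft l s t) =
     coprod_graft l (tensor_mult prod_h (tensor p (basis edge)) s) t"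
proof (induction s rule: tensor_induct)
  case s: (tensor s1 s2)
  show ?case
    by (induction t rule: tensor_induct)
      (simp_all add: coprod_graft_tensor tensor_mult_tensor prod_h_assoc coprod_graft_simps
        tensor_mult_simps)
qed (simp_all add: coprod_graft_simps tensor_mult_simps)

lemma tensor_mult_edge:
  "tensor_mult prod_h (tensor (basis edge) (basis edge)) u = u"
  "tensor_mult prod_h u (tensor (basis edge) (basis edge)) = u"
  by (induction u rule: tensor_induct; simp add: tensor_mult_tensor tensor_mult_simps)+

text \<open>
  For \<open>x = a \<box> b\<close> and \<open>y = c \<box>' d\<close>, the product of \<open>\<Delta> a \<odot> \<Delta> b + x \<otimes> 1\<close> and
  \<open>\<Delta> c \<odot>' \<Delta> d + y \<otimes> 1\<close> has five terms after expansion.  Two of them combine to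
  \<open>(\<Delta> x * \<Delta> c) \<odot>' \<Delta> d\<close> and two to \<open>\<Delta> a \<odot> (\<Delta> b * \<Delta> y)\<close>, which are the co-products of
  \<open>(x * c) \<box>' d\<close> and \<open>a \<box> (b * y)\<close> without their last terms; the fifth term \<open>(x * y) \<otimes> 1\<close> is the
  sum of these last terms.
\<close>

lemma coprod_h_prod_h_basis:
  "coprod_h (prod_h (basis x) (basis y :: lgraph \<Rightarrow>\<^sub>0 'k::comm_ring_1)) =
     tensor_mult prod_h (coprod_h (basis x)) (coprod_h (basis y))"
proof (induction x arbitrary: y rule: lgraph_induct)
  case edge
  show ?case by (simp add: coprod_h_edge tensor_mult_edge)
next
  case (graft l a b)
  note IH_b = graft.IH(2)
  show ?case
  proof (induction y rule: lgraph_induct)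
    case edge
    show ?case by (simp add: coprod_h_edge tensor_mult_edge)
  next
    case (graft m c d)
    let ?a = "basis a :: lgraph \<Rightarrow>\<^sub>0 'k" and ?b = "basis b :: lgraph \<Rightarrow>\<^sub>0 'k"
    let ?c = "basis c :: lgraph \<Rightarrow>\<^sub>0 'k" and ?d = "basis d :: lgraph \<Rightarrow>\<^sub>0 'k"
    let ?X = "graft_lin l ?a ?b" and ?Y = "graft_lin m ?c ?d"
    have IH1: "coprod_h (prod_h ?X ?c) = tensor_mult prod_h (coprod_h ?X) (coprod_h ?c)"
      using graft.IH(1) by (simp add: basis_graft)
    have IH2: "coprod_h (prod_h ?b ?Y) = tensor_mult prod_h (coprod_h ?b) (coprod_h ?Y)"
      using IH_b[of "graft m c d"] by (simp add: basis_graft)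
    have "coprod_h (prod_h ?X ?Y) =
        coprod_graft m (tensor_mult prod_h (coprod_h ?X) (coprod_h ?c)) (coprod_h ?d)
        + coprod_graft l (coprod_h ?a) (tensor_mult prod_h (coprod_h ?b) (coprod_h ?Y))
        + tensor (prod_h ?X ?Y) (basis edge)"
      unfolding prod_h_graft_lin coprod_h_simps coprod_h_graft_lin[of m "prod_h ?X ?c"]
        coprod_h_graft_lin[of l ?a "prod_h ?b ?Y"] IH1 IH2
      by (simp add: tensor_simps)
    also have "\<dots> = tensor_mult prod_h (coprod_h ?X) (coprod_h ?Y)"
      unfolding coprod_h_graft_lin
      by (simp add: tensor_mult_simps coprod_graft_simps tensor_mult_coprod_graft
          tensor_mult_coprod_graft_left tensor_mult_coprod_graft_right tensor_mult_tensor)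
    finally show ?case by (simp add: basis_graft)
  qed
qed

lemma coprod_h_prod_h:
  "coprod_h (prod_h p q) = tensor_mult prod_h (coprod_h p) (coprod_h q)"
proof (induction p rule: free_module_induct)
  case p: (basis x)
  show ?case
    by (induction q rule: free_module_induct)
      (simp_all add: prod_h_simps coprod_h_simps tensor_mult_simps coprod_h_prod_h_basis)
qed (simp_all add: prod_h_simps coprod_h_simps tensor_mult_simps)

text \<open>
  On pure tensors, the left factor of \<open>\<odot>\<close> is a product, whose co-product is the product of
  the co-products; this becomes the first two factors of the operation on triple tensors.
\<close>

lemma tensor_map_coprod_id_graft:
  "tensor_assoc (tensor_map coprod_h (\<lambda>p. p) (coprod_graft l u v)) =
     tensor_op prod_h (coprod_graft l) (tensor_assoc (tensor_map coprod_h (\<lambda>p. p) u))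
       (tensor_assoc (tensor_map coprod_h (\<lambda>p. p) v))"
proof (induction u rule: tensor_induct)
  case u: (tensor p q)
  show ?case
  proof (induction v rule: tensor_induct)
    case v: (tensor p' q')
    have "tensor_assoc (tensor (tensor_mult prod_h s t) (graft_lin l q q')) =
        tensor_op prod_h (coprod_graft l) (tensor_assoc (tensor s q)) (tensor_assoc (tensor t q'))"
      for s t
    proof (induction s rule: tensor_induct)
      case s: (tensor s1 s2)
      show ?case
        by (induction t rule: tensor_induct)
          (simp_all add: tensor_mult_tensor tensor_assoc_tensor coprod_graft_tensor
            tensor_op_tensor bilinear_map_prod_h bilinear_map_coprod_graft
            tensor_mult_simps tensor_op_simps tensor_assoc_simps tensor_simps)
    qed (simp_all add: tensor_mult_simps tensor_op_simps tensor_assoc_simps tensor_simps)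
    then show ?case
      by (simp add: coprod_graft_tensor tensor_map_tensor[OF coprod_h_linear id_linear]
          coprod_h_prod_h)
  qed (simp_all add: coprod_graft_simps tensor_op_simps tensor_assoc_simps tensor_map_simps)
qed (simp_all add: coprod_graft_simps tensor_op_simps tensor_assoc_simps tensor_map_simps)

text \<open>
  Here the co-product is applied to a graft, whose extra term \<open>(q \<box> q') \<otimes> 1\<close> gives the
  second summand.  In co-associativity that summand is matched by \<open>\<Delta> \<otimes> id\<close> of the extra
  term of the co-product itself.
\<close>

lemma tensor_map_id_coprod_graft:
  "tensor_map (\<lambda>p. p) coprod_h (coprod_graft l u v) =
     tensor_op prod_h (coprod_graft l) (tensor_map (\<lambda>p. p) coprod_h u) (tensor_map (\<lambda>p. p) coprod_h v)
     + tensor_assoc (tensor (coprod_graft l u v) (basis edge))"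
proof (induction u rule: tensor_induct)
  case u: (tensor p q)
  show ?case
    by (induction v rule: tensor_induct)
      (simp_all add: coprod_graft_tensor tensor_map_tensor[OF id_linear coprod_h_linear]
        coprod_h_graft_lin tensor_op_tensor bilinear_map_prod_h bilinear_map_coprod_graft
        tensor_assoc_tensor coprod_graft_simps tensor_op_simps tensor_assoc_simps
        tensor_map_simps tensor_simps)
qed (simp_all add: coprod_graft_simps tensor_op_simps tensor_assoc_simps tensor_map_simps
    tensor_simps)

lemma coprod_h_coassoc:
  "tensor_assoc (tensor_map coprod_h id (coprod_h p)) = tensor_map id coprod_h (coprod_h p)"
proof (induction p rule: free_module_induct)
  case (basis x)
  show ?case
  proof (induction x rule: lgraph_induct)
    case edge
    show ?case
      by (simp add: coprod_h_edge tensor_map_tensor[OF coprod_h_linear id_linear]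
          tensor_map_tensor[OF id_linear coprod_h_linear] tensor_assoc_tensor)
  next
    case (graft l a b)
    then show ?case
      by (simp add: basis_graft coprod_h_graft_lin tensor_map_simps tensor_assoc_simps
          tensor_map_coprod_id_graft tensor_map_id_coprod_graft
          tensor_map_tensor[OF coprod_h_linear id_linear]
          tensor_map_tensor[OF id_linear coprod_h_linear] tensor_simps
          coprod_h_edge tensor_assoc_tensor)
  qed
qed (simp_all add: coprod_h_simps tensor_map_simps tensor_assoc_simps)


section \<open>The counit and the filtration by order\<close>

definition counit_h :: "(lgraph \<Rightarrow>\<^sub>0 'k) \<Rightarrow> 'k::comm_ring_1" where
  "counit_h p = Poly_Mapping.lookup p edge"

lemma counit_h_simps:
  "counit_h (p + q) = counit_h p + counit_h q" "counit_h (fscale c p) = c * counit_h p"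
  by (simp_all add: counit_h_def lookup_add)

lemma counit_h_basis: "counit_h (basis x) = (if x = edge then 1 else 0)"
  by (simp add: counit_h_def basis_def lookup_single)

lemma counit_h_graft_lin [simp]: "counit_h (graft_lin l p q) = 0"
proof (induction p rule: free_module_induct)
  case p: (basis x)
  show ?case
  proof (induction q rule: free_module_induct)
    case (basis y)
    show ?case by (simp add: counit_h_basis flip: basis_graft)
  qed (simp_all add: graft_lin_simps counit_h_simps)
qed (simp_all add: graft_lin_simps counit_h_simps)

lemma counit_h_prod_h: "counit_h (prod_h p q) = counit_h p * counit_h q"
proof (induction p rule: free_module_induct)
  case p: (basis x)
  show ?case
  proof (induction q rule: free_module_induct)
    case (basis y)
    show ?case
    proof (cases x rule: lgraph_exhaust)
      case x: (graft l a b)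
      show ?thesis
        by (cases y rule: lgraph_exhaust)
          (simp_all add: x basis_graft prod_h_graft_lin counit_h_simps counit_h_basis)
    qed (simp add: counit_h_basis)
  qed (simp_all add: prod_h_simps counit_h_simps algebra_simps)
qed (simp_all add: prod_h_simps counit_h_simps algebra_simps)

lemma counit_lift_left_tensor:
  "tensor_lift fscale (\<lambda>p q. fscale (counit_h p) q) (tensor p q) = fscale (counit_h p) q"
  by (intro tensor_lift_tensor bilinear_mapI)
    (simp_all add: counit_h_simps fscale_simps mult.commute)

lemma counit_lift_right_tensor:
  "tensor_lift fscale (\<lambda>p q. fscale (counit_h q) p) (tensor p q) = fscale (counit_h q) p"
  by (intro tensor_lift_tensor bilinear_mapI)
    (simp_all add: counit_h_simps fscale_simps mult.commute)

lemma counit_lift_left_coprod_graft: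
  "tensor_lift fscale (\<lambda>p q. fscale (counit_h p) q) (coprod_graft l u v) =
     graft_lin l (tensor_lift fscale (\<lambda>p q. fscale (counit_h p) q) u)
       (tensor_lift fscale (\<lambda>p q. fscale (counit_h p) q) v)"
proof (induction u rule: tensor_induct)
  case u: (tensor p q)
  show ?case
    by (induction v rule: tensor_induct)
      (simp_all add: coprod_graft_tensor counit_lift_left_tensor counit_h_prod_h
        graft_lin_simps fscale_simps coprod_graft_simps tensor_lift_simps mult.commute)
qed (simp_all add: coprod_graft_simps graft_lin_simps tensor_lift_simps)

lemma counit_lift_right_coprod_graft:
  "tensor_lift fscale (\<lambda>p q. fscale (counit_h q) p) (coprod_graft l u v) = 0"
proof (induction u rule: tensor_induct)
  case u: (tensor p q)
  show ?case
    by (induction v rule: tensor_induct)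
      (simp_all add: coprod_graft_tensor counit_lift_right_tensor fscale_simps
        coprod_graft_simps tensor_lift_simps)
qed (simp_all add: coprod_graft_simps tensor_lift_simps)

lemma counit_left_coprod_h:
  "tensor_lift fscale (\<lambda>p q. fscale (counit_h p) q) (coprod_h p) = p"
proof (induction p rule: free_module_induct)
  case (basis x)
  show ?case
    by (induction x rule: lgraph_induct)
      (simp_all add: coprod_h_edge basis_graft coprod_h_graft_lin tensor_lift_simps
        counit_lift_left_tensor counit_lift_left_coprod_graft counit_h_basis fscale_simps)
qed (simp_all add: coprod_h_simps tensor_lift_simps)

lemma counit_right_coprod_h:
  "tensor_lift fscale (\<lambda>p q. fscale (counit_h q) p) (coprod_h p) = p"
proof (induction p rule: free_module_induct)
  case (basis x)
  show ?case
    by (cases x rule: lgraph_exhaust)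
      (simp_all add: coprod_h_edge basis_graft coprod_h_graft_lin tensor_lift_simps
        counit_lift_right_tensor counit_lift_right_coprod_graft counit_h_basis fscale_simps)
qed (simp_all add: coprod_h_simps tensor_lift_simps)

lemma keys_lin_extE:
  fixes f :: "'a \<Rightarrow> ('b \<Rightarrow>\<^sub>0 'k::comm_ring_1)"
  assumes "y \<in> Poly_Mapping.keys (lin_ext fscale f p)"
  obtains x where "x \<in> Poly_Mapping.keys p" "y \<in> Poly_Mapping.keys (f x)"
proof -
  from assms have "(\<Sum>x\<in>Poly_Mapping.keys p.
      Poly_Mapping.lookup p x * Poly_Mapping.lookup (f x) y) \<noteq> 0"
    by (simp add: in_keys_iff lin_ext_def lookup_sum)
  then obtain x where "x \<in> Poly_Mapping.keys p" "Poly_Mapping.lookup (f x) y \<noteq> 0"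
    by (metis (mono_tags, lifting) mult_zero_right sum.neutral)
  then show thesis using that by (simp add: in_keys_iff)
qed

lemma keys_basis: "Poly_Mapping.keys (basis x :: 'a \<Rightarrow>\<^sub>0 'k::comm_ring_1) = {x}"
  by (simp add: basis_def)

lemma keys_bilin_extE:
  assumes "z \<in> Poly_Mapping.keys (bilin_ext f p q)"
  obtains x y where "x \<in> Poly_Mapping.keys p" "y \<in> Poly_Mapping.keys q"
    "z \<in> Poly_Mapping.keys (f x y)"
  using assms unfolding bilin_ext_def by (elim keys_lin_extE) (rule that)

lemma keys_tensorE:
  assumes "z \<in> Poly_Mapping.keys (tensor p q)"
  obtains "fst z \<in> Poly_Mapping.keys p" "snd z \<in> Poly_Mapping.keys q"
  using assms unfolding tensor_def by (elim keys_bilin_extE) (simp add: keys_basis that)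

lemma keys_graft_linE:
  assumes "z \<in> Poly_Mapping.keys (graft_lin l p q)"
  obtains x y where "x \<in> Poly_Mapping.keys p" "y \<in> Poly_Mapping.keys q" "z = graft l x y"
  using assms unfolding graft_lin_def by (elim keys_bilin_extE) (simp add: keys_basis that)

lemma lorder_prod_graph:
  "z \<in> Poly_Mapping.keys (prod_graph x y :: lgraph \<Rightarrow>\<^sub>0 'k::comm_ring_1) \<Longrightarrow>
    lorder z = lorder x + lorder y"
proof (induction x y arbitrary: z rule: prod_graph.induct)
  case (3 l1 x' x'' l2 y' y'')
  let ?p = "graft_lin l2 (prod_graph (graft l1 x' x'') y') (basis y'') :: lgraph \<Rightarrow>\<^sub>0 'k"
  let ?q = "graft_lin l1 (basis x') (prod_graph x'' (graft l2 y' y'')) :: lgraph \<Rightarrow>\<^sub>0 'k"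
  have "z \<in> Poly_Mapping.keys ?p \<union> Poly_Mapping.keys ?q"
    using 3(3) keys_add[of ?p ?q] by auto
  then show ?case
  proof
    assume "z \<in> Poly_Mapping.keys ?p"
    then show ?thesis by (rule keys_graft_linE) (auto simp: keys_basis dest: 3(1))
  next
    assume "z \<in> Poly_Mapping.keys ?q"
    then show ?thesis by (rule keys_graft_linE) (auto simp: keys_basis dest: 3(2))
  qed
qed (simp_all add: keys_basis)

text \<open>
  Only the left factor matters for the filtration; in it the two operands are multiplied, and
  the product adds orders.
\<close>

lemma keys_coprod_graftE:
  fixes u v :: "lgraph \<times> lgraph \<Rightarrow>\<^sub>0 'k::comm_ring_1"
  assumes "z \<in> Poly_Mapping.keys (coprod_graft l u v)"
  obtains x y where "x \<in> Poly_Mapping.keys u" "y \<in> Poly_Mapping.keys v"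
    "lorder (fst z) = lorder (fst x) + lorder (fst y)"
proof -
  from assms obtain x y where x: "x \<in> Poly_Mapping.keys u" and y: "y \<in> Poly_Mapping.keys v"
    and z: "z \<in> Poly_Mapping.keys (tensor (prod_h (basis (fst x)) (basis (fst y)))
      (graft_lin l (basis (snd x)) (basis (snd y))) :: _ \<Rightarrow>\<^sub>0 'k)"
    unfolding coprod_graft_def tensor_op_def tensor_lift_def case_prod_beta
    by (elim keys_lin_extE)
  from z have "fst z \<in> Poly_Mapping.keys (prod_graph (fst x) (fst y) :: lgraph \<Rightarrow>\<^sub>0 'k)"
    unfolding prod_h_basis by (rule keys_tensorE)
  from that[OF x y lorder_prod_graph[OF this]] show thesis .
qed

lemma lorder_coprod_h:
  "z \<in> Poly_Mapping.keys (coprod_h (basis x) :: _ \<Rightarrow>\<^sub>0 'k::comm_ring_1) \<Longrightarrow>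
    lorder (fst z) \<le> lorder x"
proof (induction x arbitrary: z rule: lgraph_induct)
  case edge
  then show ?case by (simp add: coprod_h_edge tensor_basis keys_basis)
next
  case (graft l a b)
  let ?p = "coprod_graft l (coprod_h (basis a)) (coprod_h (basis b)) :: _ \<Rightarrow>\<^sub>0 'k"
  let ?q = "basis (graft l a b, edge) :: _ \<Rightarrow>\<^sub>0 'k"
  have "coprod_h (basis (graft l a b)) = ?p + ?q"
    unfolding tensor_basis[symmetric] unfolding basis_graft by (rule coprod_h_graft_lin)
  then have "z \<in> Poly_Mapping.keys ?p \<union> Poly_Mapping.keys ?q"
    using graft.prems keys_add[of ?p ?q] by auto
  then show ?case
  proof
    assume "z \<in> Poly_Mapping.keys ?p"
    then show ?thesis using graft.IH by (elim keys_coprod_graftE) fastforce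
  qed (simp add: keys_basis)
qed

interpretation trees: filtered_bialgebra
  "basis edge :: lgraph \<Rightarrow>\<^sub>0 'k::comm_ring_1" prod_h coprod_h counit_h lorder
proof unfold_locales
  fix pq x
  assume pq: "pq \<in> Poly_Mapping.keys
    (coprod_h (basis x) - tensor (basis x) (basis edge) :: _ \<Rightarrow>\<^sub>0 'k)"
  show "lorder (fst pq) < lorder x"
    \<comment> \<open>A left factor of the co-product of a graft comes from the two branches, which together
      have one vertex fewer than the graft.\<close>
  proof (cases x rule: lgraph_exhaust)
    case edge
    with pq show ?thesis by (simp add: coprod_h_edge)
  next
    case (graft l a b)
    with pq have "pq \<in> Poly_Mapping.keys
        (coprod_graft l (coprod_h (basis a)) (coprod_h (basis b)) :: _ \<Rightarrow>\<^sub>0 'k)"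
      by (simp add: basis_graft coprod_h_graft_lin)
    then show ?thesis
      by (elim keys_coprod_graftE) (auto simp: graft dest!: lorder_coprod_h)
  qed
qed (simp_all add: coprod_h_simps coprod_h_coassoc counit_left_coprod_h counit_right_coprod_h
    coprod_h_edge coprod_h_prod_h counit_h_simps counit_h_basis counit_h_prod_h fscale_simps
    distrib_left distrib_right mult.assoc)

theorem theorem3:
  shows "\<exists>counit antipode.
    free_Hopf_algebra
      (basis edge :: lgraph \<Rightarrow>\<^sub>0 'k::{comm_ring_1, ring_char_0})
      prod_h coprod_h counit antipode"
  using trees.free_Hopf_algebra_antipode by blast

end
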